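(* Let $\mathbb{A}$ be a commutative ring, let $G$ be a finite group, let $X$ be a finite set with a weight $f:X\to\mathbb{A}$, and suppose $G$ acts on the weighted set $(X,f)$. Then the weighted cardinality of the orbiquotient set $X/^{orb}G$ is $$\left|X/^{orb}G\right|_{f}=\frac{1}{|G|}\sum_{(\overline{g},h)\in P(G)}|\overline{g}|\,\left|X^{\langle g,h\rangle}\right|_{f}.$$
   Context: An $\mathbb{A}$-weighted set is a pair $(X,f)$ with $X$ a finite set and $f:X\to\mathbb{A}$ any map; its cardinality is $|X|_f=\sum_{x\in X}f(x)$, and for a subset $Y\subseteq X$ one writes $|Y|_f=\sum_{x\in Y}f(x)$. A finite group $G$ acts on $(X,f)$ if $G$ acts on $X$ and $f(gx)=f(x)$ for all $g\in G$, $x\in X$. $C(G)$ is the set of conjugacy classes of $G$; a representative $g\in G$ is fixed for each class $\overline{g}\in C(G)$, and $|\overline{g}|$ is the number of elements of the class. $Z(g)$ is the centralizer of $g$ in $G$. $X^{g}=\{x\in X\mid gx=x\}$; for a subset $S\subseteq G$, $X^{S}=\{x\in X\mid gx=x\text{ for all }g\in S\}$; $\langle g,h\rangle$ is the subgroup generated by $g$ and $h$. Set $P(G)=\{(\overline{g},h)\mid \overline{g}\in C(G),\ h\in Z(g)\}$, where $g$ is the chosen representative of $\overline{g}$. The orbiquotient of $X$ by $G$ is $X/^{orb}G=\bigsqcup_{\overline{g}\in C(G)}X^{g}/Z(g)$, where $X^g/Z(g)$ is the usual set of orbits. It is weighted by $f(\overline{x})=f(x)$ for $\overline{x}\in X^{g}/Z(g)$.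 *)

theory Defs
  imports "HOL-Algebra.Algebra"
begin

definition weighted_card :: "('a, 'r) ring_scheme \<Rightarrow> ('x \<Rightarrow> 'a) \<Rightarrow> 'x set \<Rightarrow> 'a"
  where "weighted_card A f Y = (\<Oplus>\<^bsub>A\<^esub>x\<in>Y. f x)"

definition conj_classes :: "('g, 'm) monoid_scheme \<Rightarrow> 'g set set"
  where "conj_classes G =
    orbits G (carrier G) (\<lambda>g. \<lambda>h\<in>carrier G. g \<otimes>\<^bsub>G\<^esub> h \<otimes>\<^bsub>G\<^esub> inv\<^bsub>G\<^esub> g)"

definition centralizer :: "('g, 'm) monoid_scheme \<Rightarrow> 'g \<Rightarrow> 'g set"
  where "centralizer G g = {h \<in> carrier G. h \<otimes>\<^bsub>G\<^esub> g = g \<otimes>\<^bsub>G\<^esub> h}"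

text \<open>The analogue, for a set \<open>S\<close> of group elements, of the library's \<open>invariants E act g\<close>.\<close>

definition fixed_points :: "'x set \<Rightarrow> ('g \<Rightarrow> 'x \<Rightarrow> 'x) \<Rightarrow> 'g set \<Rightarrow> 'x set"
  where "fixed_points E act S = {x \<in> E. \<forall>g\<in>S. act g x = x}"

text \<open>In the following definitions, \<open>rep\<close> is the choice of a representative of each conjugacy
  class. A class is encoded by the set of its elements.\<close>

definition class_pairs :: "('g, 'm) monoid_scheme \<Rightarrow> ('g set \<Rightarrow> 'g) \<Rightarrow> ('g set \<times> 'g) set"
  where "class_pairs G rep = (SIGMA C : conj_classes G. centralizer G (rep C))"

definition orbiquotient ::
    "('g, 'm) monoid_scheme \<Rightarrow> 'x set \<Rightarrow> ('g \<Rightarrow> 'x \<Rightarrow> 'x) \<Rightarrow> ('g set \<Rightarrow> 'g) \<Rightarrow> ('g set \<times> 'x set) set"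
  where "orbiquotient G E act rep =
    (SIGMA C : conj_classes G.
       orbits (G\<lparr>carrier := centralizer G (rep C)\<rparr>) (invariants E act (rep C)) act)"

text \<open>The weight of the orbit of \<open>x\<close> is \<open>f x\<close>: the unique value that \<open>f\<close>, being constant on
  orbits, takes on the second component of a point of the orbiquotient.\<close>

definition orbit_weight :: "('x \<Rightarrow> 'a) \<Rightarrow> 'g set \<times> 'x set \<Rightarrow> 'a"
  where "orbit_weight f p = the_elem (f ` snd p)"

end

theory Submission
  imports Defs
begin

text \<open>
  The formula is Burnside's lemma, in a weighted form, applied to each piece of the orbiquotient.

  Weighted Burnside: for a \<open>G\<close>-invariant weight \<open>f\<close>, sum \<open>f x\<close> over all pairs \<open>(g, x)\<close> with
  \<open>g x = x\<close>. Collecting by \<open>g\<close> gives the sum of the weighted cardinalities of the fixed sets.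
  Collecting by \<open>x\<close> gives every \<open>x\<close> the multiplicity \<open>|Stab x|\<close>, and along an orbit these
  multiplicities add up to \<open>|G|\<close>; so the same sum is \<open>|G|\<close> times the weighted cardinality of the
  set of orbits (lemma \<open>weighted_burnside\<close>).

  Now let \<open>g\<close> represent a class \<open>C\<close>, with centralizer \<open>Z\<close> and fixed set \<open>Y\<close>. The group \<open>Z\<close> acts
  on \<open>Y\<close>, and the points of \<open>Y\<close> fixed by \<open>h \<in> Z\<close> are the points of \<open>X\<close> fixed by the subgroup
  generated by \<open>g\<close> and \<open>h\<close> (lemma \<open>invariants_invariants\<close>). Hence \<open>|Z|\<close> times the weighted
  cardinality of \<open>Y/Z\<close> is the sum over \<open>h \<in> Z\<close> of the weighted cardinalities of these fixed sets
  (lemma \<open>weighted_burnside_centralizer\<close>). The orbit-stabilizer theorem for conjugation gives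
  \<open>|G| = |C| |Z|\<close>, so multiplying by \<open>|C|\<close> and summing over the classes yields \<open>|G| W = S\<close>. When
  \<open>|G|\<close> is a unit of the ring, dividing by it gives the formula for \<open>W\<close>.
\<close>

section \<open>Finite sums in an abelian monoid\<close>

context abelian_monoid
begin

lemma finsum_Sigma:
  assumes "finite I" "\<And>i. i \<in> I \<Longrightarrow> finite (B i)"
    and "\<And>i x. i \<in> I \<Longrightarrow> x \<in> B i \<Longrightarrow> g i x \<in> carrier G"
  shows "finsum G (\<lambda>(i, x). g i x) (SIGMA i : I. B i) = (\<Oplus>i\<in>I. \<Oplus>x\<in>B i. g i x)"
proof -
  have "finsum G (\<lambda>(i, x). g i x) (SIGMA i : I. B i)
      = finsum G (\<lambda>(i, x). g i x) (\<Union>i\<in>I. Pair i ` B i)"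
    by (rule arg_cong[where f = "finsum G _"]) auto
  also have "\<dots> = (\<Oplus>i\<in>I. finsum G (\<lambda>(i, x). g i x) (Pair i ` B i))"
    by (rule add.finprod_UN_disjoint) (use assms in \<open>auto simp: pairwise_def disjnt_def\<close>)
  also have "\<dots> = (\<Oplus>i\<in>I. \<Oplus>x\<in>B i. g i x)"
  proof (rule add.finprod_cong'[OF refl])
    show "(\<lambda>i. \<Oplus>x\<in>B i. g i x) \<in> I \<rightarrow> carrier G"
      using assms(3) by (auto intro!: finsum_closed)
    fix i assume "i \<in> I"
    then show "finsum G (\<lambda>(i, x). g i x) (Pair i ` B i) = (\<Oplus>x\<in>B i. g i x)"
      using assms(3) by (subst finsum_reindex) (auto simp: inj_on_def)
  qed
  finally show ?thesis .
qed

lemma finsum_swap_filter: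
  assumes "finite I" "finite J"
    and "\<And>i j. i \<in> I \<Longrightarrow> j \<in> J \<Longrightarrow> g i j \<in> carrier G"
  shows "(\<Oplus>i\<in>I. \<Oplus>j\<in>{j \<in> J. P i j}. g i j) = (\<Oplus>j\<in>J. \<Oplus>i\<in>{i \<in> I. P i j}. g i j)"
proof -
  let ?T = "SIGMA j : J. {i \<in> I. P i j}"
  have "(\<Oplus>i\<in>I. \<Oplus>j\<in>{j \<in> J. P i j}. g i j)
      = finsum G (\<lambda>(i, j). g i j) (SIGMA i : I. {j \<in> J. P i j})"
    by (rule finsum_Sigma[symmetric]) (use assms in auto)
  also have "(SIGMA i : I. {j \<in> J. P i j}) = prod.swap ` ?T"
    by (auto simp: image_def)
  also have "finsum G (\<lambda>(i, j). g i j) \<dots> = finsum G (\<lambda>p. (\<lambda>(i, j). g i j) (prod.swap p)) ?T"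
    by (rule finsum_reindex) (use assms in auto)
  also have "(\<lambda>p. (\<lambda>(i, j). g i j) (prod.swap p)) = (\<lambda>(j, i). g i j)"
    by auto
  also have "finsum G \<dots> ?T = (\<Oplus>j\<in>J. \<Oplus>i\<in>{i \<in> I. P i j}. g i j)"
    by (rule finsum_Sigma) (use assms in auto)
  finally show ?thesis .
qed

lemma finsum_add_pow:
  assumes "f \<in> B \<rightarrow> carrier G"
  shows "(\<Oplus>x\<in>B. [(n::nat)] \<cdot>\<^bsub>G\<^esub> f x) = [n] \<cdot>\<^bsub>G\<^esub> (\<Oplus>x\<in>B. f x)"
  using assms
proof (induction B rule: infinite_finite_induct)
  case (insert x B)
  then show ?case
    by (simp add: Pi_def add.nat_pow_distrib)
qed (auto simp: finsum_infinite)

lemma finsum_add_pow_const: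
  fixes m :: "'c \<Rightarrow> nat"
  assumes "c \<in> carrier G" "finite B"
  shows "(\<Oplus>x\<in>B. [m x] \<cdot>\<^bsub>G\<^esub> c) = [(\<Sum>x\<in>B. m x)] \<cdot>\<^bsub>G\<^esub> c"
  using assms(2)
proof (induction rule: finite_induct)
  case (insert x B)
  then show ?case
    using assms(1) by (simp add: add.nat_pow_mult)
qed simp

end

section \<open>Weighted Burnside lemma\<close>

lemma weighted_card_closed:
  assumes "abelian_monoid A" "f \<in> Y \<rightarrow> carrier A"
  shows "weighted_card A f Y \<in> carrier A"
  unfolding weighted_card_def using assms by (rule abelian_monoid.finsum_closed)

context group_action
begin

lemma eq_on_orbit_if_invariant:
  assumes "\<And>g x. g \<in> carrier G \<Longrightarrow> x \<in> E \<Longrightarrow> f (\<phi> g x) = f x"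
    and "x \<in> E" "y \<in> orbit G \<phi> x"
  shows "f y = f x"
  using assms by (auto simp: orbit_def)

lemma the_elem_image_orbit:
  assumes "\<And>g x. g \<in> carrier G \<Longrightarrow> x \<in> E \<Longrightarrow> f (\<phi> g x) = f x" "x \<in> E"
  shows "the_elem (f ` orbit G \<phi> x) = f x"
proof -
  have "f ` orbit G \<phi> x = {f x}"
    using orbit_refl[OF assms(2)] eq_on_orbit_if_invariant[of f, OF assms] by blast
  then show ?thesis
    by simp
qed

lemma finite_orbits: "finite E \<Longrightarrow> finite (orbits G E \<phi>)"
  by (simp add: orbits_def)

lemma orbits_subset: "orb \<in> orbits G E \<phi> \<Longrightarrow> orb \<subseteq> E"
  using orbits_coverture by blast

text \<open>Double counting of the pairs \<open>(g, x)\<close> with \<open>g x = x\<close>, weighted by \<open>f x\<close>. Since \<open>f\<close> is constant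
  on an orbit, the stabilizer orders of its points can be added as natural numbers before they
  multiply the common weight, and \<open>card_stablizer_sum\<close> evaluates their sum.\<close>

lemma weighted_burnside:
  assumes "abelian_monoid A" "finite (carrier G)" "finite E" "f \<in> E \<rightarrow> carrier A"
    and f_invariant: "\<And>g x. g \<in> carrier G \<Longrightarrow> x \<in> E \<Longrightarrow> f (\<phi> g x) = f x"
  shows "[order G] \<cdot>\<^bsub>A\<^esub> (\<Oplus>\<^bsub>A\<^esub>orb\<in>orbits G E \<phi>. the_elem (f ` orb))
    = (\<Oplus>\<^bsub>A\<^esub>g\<in>carrier G. weighted_card A f (invariants E \<phi> g))"
proof -
  interpret A: abelian_monoid A by fact
  have f: "f x \<in> carrier A" if "x \<in> E" for x
    using assms(4) that by auto
  have orbit_weight: "the_elem (f ` orb) = f x" if orb: "orb \<in> orbits G E \<phi>" and x: "x \<in> orb" for orb x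
  proof -
    obtain y where "y \<in> E" "orb = orbit G \<phi> y"
      using orb by (auto simp: orbits_def)
    then show ?thesis
      using the_elem_image_orbit[of f, OF f_invariant] eq_on_orbit_if_invariant[of f, OF f_invariant] x by simp
  qed
  have orbit_nonempty: "\<exists>x. x \<in> orb" if "orb \<in> orbits G E \<phi>" for orb
    using that orbit_refl by (auto simp: orbits_def)
  have closed: "the_elem (f ` orb) \<in> carrier A" if orb: "orb \<in> orbits G E \<phi>" for orb
    using orbit_nonempty[OF orb] orbit_weight[OF orb] orbits_subset[OF orb] f by force
  have "(\<Oplus>\<^bsub>A\<^esub>g\<in>carrier G. weighted_card A f (invariants E \<phi> g))
      = (\<Oplus>\<^bsub>A\<^esub>g\<in>carrier G. \<Oplus>\<^bsub>A\<^esub>x\<in>{x \<in> E. \<phi> g x = x}. f x)"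
    by (simp add: weighted_card_def invariants_def)
  also have "\<dots> = (\<Oplus>\<^bsub>A\<^esub>x\<in>E. \<Oplus>\<^bsub>A\<^esub>g\<in>{g \<in> carrier G. \<phi> g x = x}. f x)"
    by (rule A.finsum_swap_filter) (use assms f in auto)
  also have "\<dots> = (\<Oplus>\<^bsub>A\<^esub>x\<in>E. [card (stabilizer G \<phi> x)] \<cdot>\<^bsub>A\<^esub> f x)"
    by (rule A.finsum_cong') (auto simp: f stabilizer_def A.add.finprod_const)
  also have "\<dots> = (\<Oplus>\<^bsub>A\<^esub>x\<in>\<Union>(id ` orbits G E \<phi>). [card (stabilizer G \<phi> x)] \<cdot>\<^bsub>A\<^esub> f x)"
    by (simp add: orbits_coverture)
  also have "\<dots> = (\<Oplus>\<^bsub>A\<^esub>orb\<in>orbits G E \<phi>. \<Oplus>\<^bsub>A\<^esub>x\<in>id orb. [card (stabilizer G \<phi> x)] \<cdot>\<^bsub>A\<^esub> f x)"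
  proof (rule A.add.finprod_UN_disjoint)
    show "finite (orbits G E \<phi>)"
      using assms by (simp add: finite_orbits)
    show "finite (id orb)" if "orb \<in> orbits G E \<phi>" for orb
      using orbits_subset[OF that] assms(3) by (auto intro: finite_subset)
    show "pairwise (\<lambda>i j. disjnt (id i) (id j)) (orbits G E \<phi>)"
      using disjoint_union by (auto simp: pairwise_def disjnt_def)
    show "[card (stabilizer G \<phi> x)] \<cdot>\<^bsub>A\<^esub> f x \<in> carrier A"
      if "orb \<in> orbits G E \<phi>" "x \<in> id orb" for orb x
      using orbits_subset[OF that(1)] that(2) f by auto
  qed
  also have "\<dots> = (\<Oplus>\<^bsub>A\<^esub>orb\<in>orbits G E \<phi>. [order G] \<cdot>\<^bsub>A\<^esub> the_elem (f ` orb))"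
  proof (rule A.finsum_cong'[OF refl])
    show "(\<lambda>orb. [order G] \<cdot>\<^bsub>A\<^esub> the_elem (f ` orb)) \<in> orbits G E \<phi> \<rightarrow> carrier A"
      using closed by auto
    fix orb assume orb: "orb \<in> orbits G E \<phi>"
    have "(\<Oplus>\<^bsub>A\<^esub>x\<in>id orb. [card (stabilizer G \<phi> x)] \<cdot>\<^bsub>A\<^esub> f x)
        = (\<Oplus>\<^bsub>A\<^esub>x\<in>orb. [card (stabilizer G \<phi> x)] \<cdot>\<^bsub>A\<^esub> the_elem (f ` orb))"
      by (rule A.finsum_cong') (use closed[OF orb] orbit_weight[OF orb] in auto)
    also have "\<dots> = [(\<Sum>x\<in>orb. card (stabilizer G \<phi> x))] \<cdot>\<^bsub>A\<^esub> the_elem (f ` orb)"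
      using closed[OF orb] orbits_subset[OF orb] assms(3)
      by (intro A.finsum_add_pow_const) (auto intro: finite_subset)
    finally show "(\<Oplus>\<^bsub>A\<^esub>x\<in>id orb. [card (stabilizer G \<phi> x)] \<cdot>\<^bsub>A\<^esub> f x)
        = [order G] \<cdot>\<^bsub>A\<^esub> the_elem (f ` orb)"
      by (simp add: card_stablizer_sum assms(2) orb)
  qed
  also have "\<dots> = [order G] \<cdot>\<^bsub>A\<^esub> (\<Oplus>\<^bsub>A\<^esub>orb\<in>orbits G E \<phi>. the_elem (f ` orb))"
    by (rule A.finsum_add_pow) (use closed in auto)
  finally show ?thesis
    by simp
qed

section \<open>The action of a centralizer on a fixed set\<close>

text \<open>Elements of \<open>Bij Y\<close> are extensional on \<open>Y\<close>, so the action on a stable subset has to be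
  restricted to it. Orbits and fixed points inside \<open>Y\<close> do not see the restriction (lemmas
  \<open>orbits_restrict\<close> and \<open>invariants_restrict\<close>).\<close>

lemma restricted_action:
  assumes "subgroup H G" "Y \<subseteq> E" and stable: "\<And>h y. h \<in> H \<Longrightarrow> y \<in> Y \<Longrightarrow> \<phi> h y \<in> Y"
  shows "group_action (G\<lparr>carrier := H\<rparr>) Y (\<lambda>h. restrict (\<phi> h) Y)"
proof -
  interpret G: group G
    using group_hom group_hom.axioms(1) by auto
  interpret H: subgroup H G by fact
  have bij: "restrict (\<phi> h) Y \<in> Bij Y" if h: "h \<in> H" for h
  proof -
    have "y \<in> \<phi> h ` Y" if "y \<in> Y" for y
    proof
      show "\<phi> (inv h) y \<in> Y"
        using stable h that by simp
      show "y = \<phi> h (\<phi> (inv h) y)"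
        using orbit_sym_aux[of "inv h" y] h that assms(2) by auto
    qed
    then have "\<phi> h ` Y = Y"
      using stable[OF h] by blast
    moreover have "inj_on (\<phi> h) Y"
      using inj_prop h assms(2) by (meson H.mem_carrier inj_on_subset)
    ultimately show ?thesis
      by (simp add: Bij_def bij_betw_def inj_on_restrict_eq)
  qed
  have "restrict (\<phi> (h \<otimes> k)) Y = compose Y (restrict (\<phi> h) Y) (restrict (\<phi> k) Y)"
    if "h \<in> H" "k \<in> H" for h k
    using that assms(2) stable
    by (auto simp: compose_def fun_eq_iff restrict_def composition_rule subset_iff)
  then have "(\<lambda>h. restrict (\<phi> h) Y) \<in> hom (G\<lparr>carrier := H\<rparr>) (BijGroup Y)"
    using bij by (auto simp: hom_def BijGroup_def)
  then show ?thesis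
    unfolding group_action_def group_hom_def group_hom_axioms_def
    using G.subgroup_imp_group[OF assms(1)] group_BijGroup by blast
qed

text \<open>Being fixed by \<open>S\<close> is the condition that the stabilizer contains \<open>S\<close>; as the stabilizer is a
  subgroup, it then contains all that \<open>S\<close> generates.\<close>

lemma fixed_points_generate:
  assumes "S \<subseteq> carrier G"
  shows "fixed_points E \<phi> (generate G S) = fixed_points E \<phi> S"
proof -
  interpret G: group G
    using group_hom group_hom.axioms(1) by auto
  have "generate G S \<subseteq> stabilizer G \<phi> x" if "x \<in> E" "\<forall>g\<in>S. \<phi> g x = x" for x
    by (rule G.generate_subgroup_incl) (use that assms stabilizer_subgroup in \<open>auto simp: stabilizer_def\<close>)
  then show ?thesis
    by (fastforce simp: fixed_points_def stabilizer_def intro: generate.incl)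
qed

text \<open>This turns the fixed sets that Burnside's lemma produces for the centralizer of \<open>g\<close> into those
  indexed by the pairs \<open>(g, h)\<close> in the formula.\<close>

lemma invariants_invariants:
  assumes "g \<in> carrier G" "h \<in> carrier G"
  shows "invariants (invariants E \<phi> g) \<phi> h = fixed_points E \<phi> (generate G {g, h})"
  using assms fixed_points_generate[of "{g, h}"] by (auto simp: invariants_def fixed_points_def)

lemma centralizer_stable_invariants:
  assumes "g \<in> carrier G" "h \<in> centralizer G g" "x \<in> invariants E \<phi> g"
  shows "\<phi> h x \<in> invariants E \<phi> g"
proof -
  have h: "h \<in> carrier G" "h \<otimes> g = g \<otimes> h" and x: "x \<in> E" "\<phi> g x = x"
    using assms by (auto simp: centralizer_def invariants_def)
  have "\<phi> g (\<phi> h x) = \<phi> (g \<otimes> h) x"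
    by (rule composition_rule[symmetric]) (use assms(1) h x in auto)
  also have "\<dots> = \<phi> (h \<otimes> g) x"
    by (simp only: h(2))
  also have "\<dots> = \<phi> h (\<phi> g x)"
    by (rule composition_rule) (use assms(1) h x in auto)
  finally show ?thesis
    using element_image[OF h(1) x(1) refl] x(2) by (simp add: invariants_def)
qed

end

lemma (in group) centralizer_eq_stabilizer:
  assumes "g \<in> carrier G"
  shows "centralizer G g
    = stabilizer G (\<lambda>g. \<lambda>h\<in>carrier G. g \<otimes> h \<otimes> inv g) g"
  using assms by (auto simp: centralizer_def stabilizer_def inv_solve_right')

lemma (in group) subgroup_centralizer:
  assumes "g \<in> carrier G"
  shows "subgroup (centralizer G g) G"
  unfolding centralizer_eq_stabilizer[OF assms]
  using action_by_conjugation assms by (rule group_action.stabilizer_subgroup)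

lemma (in group) conj_class_subset:
  assumes "C \<in> conj_classes G"
  shows "C \<subseteq> carrier G"
  using group_action.orbits_subset[OF action_by_conjugation] assms
  by (auto simp: conj_classes_def)

lemma (in group) card_conj_class_times_card_centralizer:
  assumes "C \<in> conj_classes G" "g \<in> C"
  shows "card C * card (centralizer G g) = order G"
proof -
  interpret conj: group_action G "carrier G" "\<lambda>g. \<lambda>h\<in>carrier G. g \<otimes> h \<otimes> inv g"
    by (rule action_by_conjugation)
  have g: "g \<in> carrier G"
    using conj_class_subset assms by blast
  have "orbit G (\<lambda>g. \<lambda>h\<in>carrier G. g \<otimes> h \<otimes> inv g) g = C"
    using conj.disjoint_union[of C "orbit G (\<lambda>g. \<lambda>h\<in>carrier G. g \<otimes> h \<otimes> inv g) g"]
      conj.orbit_refl[OF g] assms g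
    by (auto simp: conj_classes_def orbits_def)
  then show ?thesis
    using conj.orbit_stabilizer_theorem[OF g] centralizer_eq_stabilizer[OF g] by simp
qed

lemma orbits_restrict: "orbits H Y (\<lambda>h. restrict (\<phi> h) Y) = orbits H Y \<phi>"
  by (auto simp: orbits_def orbit_def)

lemma invariants_restrict: "invariants Y (\<lambda>h. restrict (\<phi> h) Y) h = invariants Y \<phi> h"
  by (auto simp: invariants_def)

lemma (in group_action) weighted_burnside_centralizer:
  assumes "abelian_monoid A" "finite (carrier G)" "finite E" "f \<in> E \<rightarrow> carrier A"
    and "\<And>g x. g \<in> carrier G \<Longrightarrow> x \<in> E \<Longrightarrow> f (\<phi> g x) = f x"
    and g: "g \<in> carrier G"
  shows "[card (centralizer G g)] \<cdot>\<^bsub>A\<^esub>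
      (\<Oplus>\<^bsub>A\<^esub>orb\<in>orbits (G\<lparr>carrier := centralizer G g\<rparr>) (invariants E \<phi> g) \<phi>. the_elem (f ` orb))
    = (\<Oplus>\<^bsub>A\<^esub>h\<in>centralizer G g. weighted_card A f (fixed_points E \<phi> (generate G {g, h})))"
proof -
  interpret A: abelian_monoid A by fact
  interpret G: group G
    using group_hom group_hom.axioms(1) by auto
  let ?Z = "centralizer G g" and ?Y = "invariants E \<phi> g"
  have YE: "?Y \<subseteq> E" and ZG: "?Z \<subseteq> carrier G"
    by (auto simp: invariants_def centralizer_def)
  interpret Z: group_action "G\<lparr>carrier := ?Z\<rparr>" ?Y "\<lambda>h. restrict (\<phi> h) ?Y"
    using G.subgroup_centralizer[OF g] YE centralizer_stable_invariants[OF g]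
    by (rule restricted_action)
  have "[order (G\<lparr>carrier := ?Z\<rparr>)] \<cdot>\<^bsub>A\<^esub>
      (\<Oplus>\<^bsub>A\<^esub>orb\<in>orbits (G\<lparr>carrier := ?Z\<rparr>) ?Y (\<lambda>h. restrict (\<phi> h) ?Y). the_elem (f ` orb))
    = (\<Oplus>\<^bsub>A\<^esub>h\<in>carrier (G\<lparr>carrier := ?Z\<rparr>).
        weighted_card A f (invariants ?Y (\<lambda>h. restrict (\<phi> h) ?Y) h))"
    using assms(1,3,4) YE ZG finite_subset[OF YE] finite_subset[OF ZG] assms(2)
    by (intro Z.weighted_burnside) (auto intro!: assms(5))
  also have "\<dots> = (\<Oplus>\<^bsub>A\<^esub>h\<in>?Z. weighted_card A f (fixed_points E \<phi> (generate G {g, h})))"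
  proof (rule A.finsum_cong')
    show "(\<lambda>h. weighted_card A f (fixed_points E \<phi> (generate G {g, h}))) \<in> ?Z \<rightarrow> carrier A"
      using assms(1,4) by (auto intro!: weighted_card_closed simp: fixed_points_def)
  qed (use ZG g in \<open>auto simp: invariants_restrict invariants_invariants\<close>)
  finally show ?thesis
    by (simp add: orbits_restrict order_def)
qed

section \<open>The orbiquotient\<close>

theorem theorem2:
  fixes A :: "('a, 'r) ring_scheme"
    and G :: "('g, 'm) monoid_scheme"
    and E :: "'x set"
    and f :: "'x \<Rightarrow> 'a"
    and act :: "'g \<Rightarrow> 'x \<Rightarrow> 'x"
    and rep :: "'g set \<Rightarrow> 'g"
  assumes "cring A"
    and "group G"
    and "finite (carrier G)"
    and "finite E"
    and "f \<in> E \<rightarrow> carrier A"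
    and "group_action G E act"
    and "\<And>g x. g \<in> carrier G \<Longrightarrow> x \<in> E \<Longrightarrow> f (act g x) = f x"
    and "\<And>C. C \<in> conj_classes G \<Longrightarrow> rep C \<in> C"
  defines "W \<equiv> weighted_card A (orbit_weight f) (orbiquotient G E act rep)"
    and "S \<equiv> finsum A
      (\<lambda>(C, h). [card C] \<cdot>\<^bsub>A\<^esub> weighted_card A f (fixed_points E act (generate G {rep C, h})))
      (class_pairs G rep)"
  shows "([order G] \<cdot>\<^bsub>A\<^esub> \<one>\<^bsub>A\<^esub> \<in> Units A \<longrightarrow> W = inv\<^bsub>A\<^esub> ([order G] \<cdot>\<^bsub>A\<^esub> \<one>\<^bsub>A\<^esub>) \<otimes>\<^bsub>A\<^esub> S)
         \<and> [order G] \<cdot>\<^bsub>A\<^esub> W = S"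
proof -
  interpret A: cring A by fact
  interpret G: group G by fact
  interpret group_action G E act by fact
  let ?Z = "\<lambda>C. centralizer G (rep C)"
  let ?O = "\<lambda>C. orbits (G\<lparr>carrier := ?Z C\<rparr>) (invariants E act (rep C)) act"
  let ?w = "\<lambda>C. \<Oplus>\<^bsub>A\<^esub>orb\<in>?O C. the_elem (f ` orb)"
  let ?F = "\<lambda>C h. weighted_card A f (fixed_points E act (generate G {rep C, h}))"
  have am: "abelian_monoid A"
    by unfold_locales
  have rep: "rep C \<in> carrier G" if "C \<in> conj_classes G" for C
    using assms(8)[OF that] G.conj_class_subset[OF that] by blast
  have fin_classes: "finite (conj_classes G)"
    using group_action.finite_orbits[OF G.action_by_conjugation assms(3)]
    by (simp add: conj_classes_def)
  have fin_Z: "finite (?Z C)" for C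
    by (rule finite_subset[OF _ assms(3)]) (auto simp: centralizer_def)
  have fin_O: "finite (?O C)" for C
    using assms(4) by (simp add: orbits_def invariants_def)
  have F_closed: "?F C h \<in> carrier A" for C h
    using am by (rule weighted_card_closed) (use assms(5) in \<open>auto simp: fixed_points_def\<close>)
  have orb_closed: "the_elem (f ` orb) \<in> carrier A" if C: "C \<in> conj_classes G" and orb: "orb \<in> ?O C" for C orb
  proof -
    obtain x where x: "x \<in> E" "orb = orbit (G\<lparr>carrier := ?Z C\<rparr>) act x"
      using orb by (auto simp: orbits_def invariants_def)
    have "\<one>\<^bsub>G\<^esub> \<in> ?Z C"
      using rep[OF C] by (simp add: centralizer_def)
    then have "orb \<noteq> {}"
      unfolding x(2) orbit_def by auto
    moreover have "f ` orb = (\<lambda>_. f x) ` orb"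
      using x assms(7) by (intro image_cong) (auto simp: orbit_def centralizer_def)
    ultimately have "f ` orb = {f x}"
      by (simp add: image_constant_conv)
    then show ?thesis
      using assms(5) x by auto
  qed
  have w_closed: "?w C \<in> carrier A" if "C \<in> conj_classes G" for C
    using orb_closed[OF that] by (auto intro!: A.finsum_closed)
  have W: "W = (\<Oplus>\<^bsub>A\<^esub>C\<in>conj_classes G. ?w C)"
  proof -
    have "W = finsum A (\<lambda>(C, orb). the_elem (f ` orb)) (SIGMA C : conj_classes G. ?O C)"
      by (simp add: W_def weighted_card_def orbiquotient_def orbit_weight_def[abs_def] case_prod_unfold)
    also have "\<dots> = (\<Oplus>\<^bsub>A\<^esub>C\<in>conj_classes G. ?w C)"
      by (rule A.finsum_Sigma) (use fin_classes fin_O orb_closed in auto)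
    finally show ?thesis .
  qed
  have W_closed: "W \<in> carrier A"
    unfolding W using w_closed by (auto intro!: A.finsum_closed)
  have "[order G] \<cdot>\<^bsub>A\<^esub> W = (\<Oplus>\<^bsub>A\<^esub>C\<in>conj_classes G. [order G] \<cdot>\<^bsub>A\<^esub> ?w C)"
    unfolding W by (rule A.finsum_add_pow[symmetric]) (use w_closed in auto)
  also have "\<dots> = (\<Oplus>\<^bsub>A\<^esub>C\<in>conj_classes G. \<Oplus>\<^bsub>A\<^esub>h\<in>?Z C. [card C] \<cdot>\<^bsub>A\<^esub> ?F C h)"
  proof (rule A.finsum_cong'[OF refl])
    show "(\<lambda>C. \<Oplus>\<^bsub>A\<^esub>h\<in>?Z C. [card C] \<cdot>\<^bsub>A\<^esub> ?F C h) \<in> conj_classes G \<rightarrow> carrier A"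
      using F_closed by (auto intro!: A.finsum_closed)
    fix C assume C: "C \<in> conj_classes G"
    have "[order G] \<cdot>\<^bsub>A\<^esub> ?w C = [card C] \<cdot>\<^bsub>A\<^esub> ([card (?Z C)] \<cdot>\<^bsub>A\<^esub> ?w C)"
      using G.card_conj_class_times_card_centralizer[OF C assms(8)[OF C]] w_closed[OF C]
      by (simp add: A.add.nat_pow_pow mult.commute)
    also have "\<dots> = [card C] \<cdot>\<^bsub>A\<^esub> (\<Oplus>\<^bsub>A\<^esub>h\<in>?Z C. ?F C h)"
      using weighted_burnside_centralizer[OF am assms(3,4,5,7) rep[OF C]] by simp
    also have "\<dots> = (\<Oplus>\<^bsub>A\<^esub>h\<in>?Z C. [card C] \<cdot>\<^bsub>A\<^esub> ?F C h)"
      by (rule A.finsum_add_pow[symmetric]) (use F_closed in auto)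
    finally show "[order G] \<cdot>\<^bsub>A\<^esub> ?w C = (\<Oplus>\<^bsub>A\<^esub>h\<in>?Z C. [card C] \<cdot>\<^bsub>A\<^esub> ?F C h)" .
  qed
  also have "\<dots> = S"
    unfolding S_def class_pairs_def
    by (rule A.finsum_Sigma[symmetric]) (use fin_classes fin_Z F_closed in auto)
  finally have eq: "[order G] \<cdot>\<^bsub>A\<^esub> W = S" .
  have "W = inv\<^bsub>A\<^esub> ([order G] \<cdot>\<^bsub>A\<^esub> \<one>\<^bsub>A\<^esub>) \<otimes>\<^bsub>A\<^esub> S" if unit: "[order G] \<cdot>\<^bsub>A\<^esub> \<one>\<^bsub>A\<^esub> \<in> Units A"
  proof -
    have "S = ([order G] \<cdot>\<^bsub>A\<^esub> \<one>\<^bsub>A\<^esub>) \<otimes>\<^bsub>A\<^esub> W"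
      using W_closed eq by (simp add: A.add_pow_ldistr)
    then show ?thesis
      using unit W_closed by (simp add: A.m_assoc[symmetric])
  qed
  with eq show ?thesis
    by blast
qed

end
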